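(* Let $\gamma/\lambda$ be a skew shape. If $\mu=(\mu_1,\mu_2,\ldots)$ is a partition with $c^{\gamma}_{\lambda,\mu}\neq0$, then for all $i\ge1$, $$\partial_{(i)}(\gamma/\lambda)\le_{GDom}(\mu_{i+1},\mu_{i+2},\ldots).$$ Moreover, for $\mu=\partial_{(0)}(\gamma/\lambda)$ one has $c^{\gamma}_{\lambda,\mu}=1$; that is, $\partial_{(0)}(\gamma/\lambda)$ is the minimum partition $\mu$ with $c^{\gamma}_{\lambda,\mu}\neq0$ with respect to the generalized dominance order.
   Context: For partitions $\lambda\subseteq\gamma$ (with $\lambda$ padded by zeros), the skew shape $\gamma/\lambda$ is the set of cells $(i,j)$ (row $i$ from the top, column $j$ from the left) with $\lambda_i<j\le\gamma_i$. For a finite set $S$ of cells in the grid, $\uparrow_\leftarrow(S)$ denotes the partition obtained by listing the numbers of cells of $S$ in each row in non-increasing order (zeros discarded). For $i\ge1$, $\gamma/\lambda_{(i)}$ denotes the set of cells obtained from $\gamma/\lambda$ by deleting the top $i$ cells of each column (all cells of a column if it has at most $i$ cells). Lower derivations: $\partial_{(0)}(\gamma/\lambda)=\uparrow_\leftarrow(\gamma/\lambda)$ and, for $i\ge1$, $\partial_{(i)}(\gamma/\lambda)=\uparrow_\leftarrow(\gamma/\lambda_{(i)})$. Generalized dominance order: for a partition $\alpha=(\alpha_1,\ldots,\alpha_k)$ of $n$ and a partition $\beta=(\beta_1,\ldots,\beta_l)$ of $m$ with $n\le m$, $\alpha\le_{GDom}\beta$ means $\alpha_1+\cdots+\alpha_j\le\beta_1+\cdots+\beta_j$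 for all $1\le j\le\min\{k,l\}$. $c^{\gamma}_{\lambda,\mu}$ is the Littlewood–Richardson coefficient ($s_\lambda s_\mu=\sum_\gamma c^\gamma_{\lambda,\mu}s_\gamma$), equal to the number of Littlewood–Richardson tableaux of shape $\gamma/\lambda$ and content $\mu$, i.e. semi-standard tableaux of shape $\gamma/\lambda$ (rows weakly increasing left to right, columns strictly increasing downward) with $\mu_i$ labels equal to $i$, whose reverse row word (rows read right to left, top row first) is a lattice word (every prefix contains, for each $b\ge2$, at most as many $b$'s as $(b-1)$'s). *)

theory Defs
  imports Main "HOL-Library.FuncSet"
begin

text \<open>
  Partitions are weakly decreasing lists of positive integers. Rows, columns and labels are
  numbered from 1 (English notation: row 1 on top, column 1 on the left), and
  \<open>part p i\<close> is the \<open>i\<close>-th part of \<open>p\<close>, padded by zeros.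
\<close>

definition is_partition :: "nat list \<Rightarrow> bool" where
  "is_partition p \<longleftrightarrow> sorted_wrt (\<ge>) p \<and> (\<forall>x\<in>set p. 0 < x)"

definition part :: "nat list \<Rightarrow> nat \<Rightarrow> nat" where
  "part p i = (if 1 \<le> i \<and> i \<le> length p then p ! (i - 1) else 0)"

definition part_contained :: "nat list \<Rightarrow> nat list \<Rightarrow> bool" where
  "part_contained lam \<gamma> \<longleftrightarrow> (\<forall>i\<ge>1. part lam i \<le> part \<gamma> i)"

definition skew_shape :: "nat list \<Rightarrow> nat list \<Rightarrow> (nat \<times> nat) set" where
  "skew_shape \<gamma> lam = {(i, j). 1 \<le> i \<and> part lam i < j \<and> j \<le> part \<gamma> i}"

text \<open>
  For finite \<open>S\<close>, the row lengths of \<open>S\<close> in non-increasing order. Only the rows in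
  \<open>fst ` S\<close>, i.e. the nonempty ones, are listed, so no zeros occur.
\<close>

definition row_partition :: "(nat \<times> nat) set \<Rightarrow> nat list" where
  "row_partition S =
     rev (sort (map (\<lambda>i. card {j. (i, j) \<in> S}) (sorted_list_of_set (fst ` S))))"

text \<open>A cell survives iff at least \<open>i\<close> cells of \<open>S\<close> lie above it in its column.\<close>

definition delete_top :: "nat \<Rightarrow> (nat \<times> nat) set \<Rightarrow> (nat \<times> nat) set" where
  "delete_top i S = {(r, c) \<in> S. i \<le> card {r'. r' < r \<and> (r', c) \<in> S}}"

definition lower_deriv :: "nat \<Rightarrow> (nat \<times> nat) set \<Rightarrow> nat list" where
  "lower_deriv i S = (if i = 0 then row_partition S else row_partition (delete_top i S))"

definition gdom_le :: "nat list \<Rightarrow> nat list \<Rightarrow> bool" (infix "\<le>\<^sub>G" 50) where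
  "\<alpha> \<le>\<^sub>G \<beta> \<longleftrightarrow> sum_list \<alpha> \<le> sum_list \<beta> \<and>
     (\<forall>j. 1 \<le> j \<and> j \<le> min (length \<alpha>) (length \<beta>) \<longrightarrow>
        sum_list (take j \<alpha>) \<le> sum_list (take j \<beta>))"

text \<open>
  Tableaux are extensional functions (arbitrary but fixed value outside \<open>S\<close>), so that
  distinct functions are distinct tableaux and the tableaux can be counted.
\<close>

definition semistandard :: "(nat \<times> nat) set \<Rightarrow> (nat \<times> nat \<Rightarrow> nat) \<Rightarrow> bool" where
  "semistandard S T \<longleftrightarrow>
     T \<in> S \<rightarrow>\<^sub>E {1..} \<and>
     (\<forall>i j j'. (i, j) \<in> S \<and> (i, j') \<in> S \<and> j < j' \<longrightarrow> T (i, j) \<le> T (i, j')) \<and>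
     (\<forall>i i' j. (i, j) \<in> S \<and> (i', j) \<in> S \<and> i < i' \<longrightarrow> T (i, j) < T (i', j))"

definition has_content :: "(nat \<times> nat) set \<Rightarrow> (nat \<times> nat \<Rightarrow> nat) \<Rightarrow> nat list \<Rightarrow> bool" where
  "has_content S T \<mu> \<longleftrightarrow> (\<forall>k\<ge>1. card {x \<in> S. T x = k} = part \<mu> k)"

definition reverse_row_word :: "(nat \<times> nat) set \<Rightarrow> (nat \<times> nat \<Rightarrow> nat) \<Rightarrow> nat list" where
  "reverse_row_word S T =
     concat (map (\<lambda>i. map (\<lambda>j. T (i, j)) (rev (sorted_list_of_set {j. (i, j) \<in> S})))
       (sorted_list_of_set (fst ` S)))"

definition lattice_word :: "nat list \<Rightarrow> bool" where
  "lattice_word w \<longleftrightarrow>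
     (\<forall>n b. 2 \<le> b \<longrightarrow> count_list (take n w) b \<le> count_list (take n w) (b - 1))"

definition lr_tableaux :: "nat list \<Rightarrow> nat list \<Rightarrow> nat list \<Rightarrow> (nat \<times> nat \<Rightarrow> nat) set" where
  "lr_tableaux \<gamma> lam \<mu> =
     {T. semistandard (skew_shape \<gamma> lam) T \<and> has_content (skew_shape \<gamma> lam) T \<mu> \<and>
         lattice_word (reverse_row_word (skew_shape \<gamma> lam) T)}"

text \<open>
  The Littlewood--Richardson coefficient \<open>c\<^sup>\<gamma>\<close> indexed by \<open>lam\<close> and \<open>\<mu>\<close>, by the
  Littlewood--Richardson rule.
\<close>

definition lr_coeff :: "nat list \<Rightarrow> nat list \<Rightarrow> nat list \<Rightarrow> nat" where
  "lr_coeff \<gamma> lam \<mu> = card (lr_tableaux \<gamma> lam \<mu>)"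

end

theory Submission
  imports "HOL-Library.Multiset" Defs
begin

text \<open>
  Let \<open>n k r\<close> be the number of labels \<open>k\<close> in row \<open>r\<close> of a Littlewood--Richardson tableau and
  \<open>N k r\<close> their number strictly above row \<open>r\<close>. Reading row \<open>r\<close> up to its last label \<open>k + 1\<close>, the
  lattice condition says \<open>N (k + 1) (r + 1) \<le> N k r\<close>. Telescoping, the labels larger than \<open>m\<close>
  in row \<open>r\<close> number at most \<open>N m r\<close>, and adding rows from top to bottom shows that \<open>j\<close> rows
  contain at most \<open>\<mu>\<^sub>i\<^sub>+\<^sub>1 + \<dots> + \<mu>\<^sub>i\<^sub>+\<^sub>j\<close> labels larger than \<open>i\<close>. A cell that
  survives the deletion of the top \<open>i\<close> cells of its column has such a label by column
  strictness, which gives the dominance bounds. If \<open>\<mu>\<close> consists of the sorted row lengths,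
  the same bounds and the interlacing of \<open>N \<cdot> r\<close> with \<open>N \<cdot> (r + 1)\<close> determine all counts
  from the bottom row upwards, and an explicit tableau realizes them.
\<close>

section \<open>Words and initial segments of cells\<close>

definition read_before :: "nat \<times> nat \<Rightarrow> nat \<times> nat \<Rightarrow> bool" where
  "read_before x y \<longleftrightarrow> fst x < fst y \<or> fst x = fst y \<and> snd y < snd x"

text \<open>These are the cell sets of the prefixes of the reading word. Down-closed sets let the
  lattice condition be tested on cells instead of list positions.\<close>

definition initial_segment :: "(nat \<times> nat) set \<Rightarrow> (nat \<times> nat) set \<Rightarrow> bool" where
  "initial_segment S D \<longleftrightarrow> D \<subseteq> S \<and> (\<forall>x\<in>D. \<forall>y\<in>S. read_before y x \<longrightarrow> y \<in> D)"

definition reading_order :: "(nat \<times> nat) set \<Rightarrow> (nat \<times> nat) list" where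
  "reading_order S = concat (map (\<lambda>i. map (Pair i) (rev (sorted_list_of_set {j. (i, j) \<in> S})))
     (sorted_list_of_set (fst ` S)))"

lemma finite_row: "finite S \<Longrightarrow> finite {j. (i, j) \<in> S}"
  by (rule finite_subset[of _ "snd ` S"]) force+

lemma finite_row_Collect: "finite S \<Longrightarrow> finite {j. (i, j) \<in> S \<and> P j}"
  by (rule finite_subset[OF _ finite_row[of S i]]) auto

lemma reverse_row_word_eq: "reverse_row_word S T = map T (reading_order S)"
  by (simp add: reverse_row_word_def reading_order_def map_concat comp_def)

lemma set_reading_order: "finite S \<Longrightarrow> set (reading_order S) = S"
  by (force simp: reading_order_def finite_row)

lemma sorted_wrt_rows:
  assumes "sorted_wrt (<) is" "\<And>i. sorted_wrt (>) (f i)"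
  shows "sorted_wrt read_before (concat (map (\<lambda>i. map (Pair i) (f i)) is))"
  using assms(1)
  by (induction "is") (auto simp: sorted_wrt_append sorted_wrt_map read_before_def assms(2))

lemma sorted_reading_order: "sorted_wrt read_before (reading_order S)"
  unfolding reading_order_def
  by (rule sorted_wrt_rows) (simp_all add: sorted_wrt_rev)

lemma read_before_asym: "read_before x y \<Longrightarrow> \<not> read_before y x"
  by (auto simp: read_before_def)

lemma distinct_if_sorted_read_before: "sorted_wrt read_before W \<Longrightarrow> distinct W"
  by (induction W) (auto dest: read_before_asym)

lemma initial_segment_take:
  assumes "finite S"
  shows "initial_segment S (set (take n (reading_order S)))"
proof -
  let ?W = "reading_order S"
  have *: "y \<in> set (take n ?W)"
    if "x \<in> set (take n ?W)" "y \<in> S" "read_before y x" for x y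
  proof (rule ccontr)
    assume "y \<notin> set (take n ?W)"
    moreover have "y \<in> set (take n ?W @ drop n ?W)"
      using that(2) set_reading_order[OF assms] by simp
    ultimately have "y \<in> set (drop n ?W)"
      by (metis Un_iff set_append)
    moreover have "sorted_wrt read_before (take n ?W @ drop n ?W)"
      using sorted_reading_order by simp
    ultimately have "read_before x y"
      using that(1) unfolding sorted_wrt_append by blast
    then show False
      using that(3) read_before_asym by blast
  qed
  then show ?thesis
    using set_take_subset[of n ?W] set_reading_order[OF assms]
    unfolding initial_segment_def by blast
qed

text \<open>Take the longest prefix of the reading order inside \<open>D\<close>. The first cell
  \<open>h\<close> outside \<open>D\<close> is read before every later cell, so a cell of
  \<open>D\<close> beyond the prefix would force \<open>h\<close> into \<open>D\<close>.\<close>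

lemma initial_segment_eq_take:
  assumes "finite S" "initial_segment S D"
  obtains n where "set (take n (reading_order S)) = D"
proof -
  let ?W = "reading_order S"
  let ?t = "takeWhile (\<lambda>x. x \<in> D) ?W" and ?d = "dropWhile (\<lambda>x. x \<in> D) ?W"
  have W: "?W = ?t @ ?d"
    by simp
  have "set ?t \<subseteq> D"
    by (auto dest: set_takeWhileD)
  moreover have "D \<subseteq> set ?t"
  proof
    fix y assume y: "y \<in> D"
    show "y \<in> set ?t"
    proof (rule ccontr)
      assume "y \<notin> set ?t"
      moreover have "y \<in> set (?t @ ?d)"
        using y assms set_reading_order[OF assms(1)] W unfolding initial_segment_def by auto
      ultimately have yd: "y \<in> set ?d"
        by (metis Un_iff set_append)
      then obtain h ds where hd: "?d = h # ds"
        by (cases ?d) auto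
      have "h \<notin> D"
        using hd by (metis dropWhile_eq_Cons_conv)
      then have "y \<noteq> h"
        using y by blast
      moreover have "sorted_wrt read_before ?d"
        using sorted_reading_order[of S] W by (metis sorted_wrt_append)
      ultimately have "read_before h y"
        using yd hd by auto
      moreover have "h \<in> S"
        using hd W set_reading_order[OF assms(1)]
        by (metis list.set_intros(1) set_dropWhileD)
      ultimately have "h \<in> D"
        using y assms(2) unfolding initial_segment_def by blast
      then show False
        using \<open>h \<notin> D\<close> by blast
    qed
  qed
  ultimately have "set (take (length ?t) ?W) = D"
    by (metis subset_antisym takeWhile_eq_take)
  then show thesis
    using that by blast
qed

lemma count_list_map_distinct:
  "distinct W \<Longrightarrow> count_list (map T W) b = card {x \<in> set W. T x = b}"
proof (induction W)
  case (Cons x W)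
  have "{y \<in> set (x # W). T y = b} =
      (if T x = b then insert x {y \<in> set W. T y = b} else {y \<in> set W. T y = b})"
    by auto
  then show ?case
    using Cons by simp
qed simp

lemma count_list_take_word:
  "count_list (take n (reverse_row_word S T)) b =
     card {x \<in> set (take n (reading_order S)). T x = b}"
  unfolding reverse_row_word_eq take_map
  by (intro count_list_map_distinct distinct_take distinct_if_sorted_read_before
      sorted_reading_order)

text \<open>The reading order lists each cell once, so counting letters in a prefix is counting
  cells, and the cell sets of prefixes are exactly the initial segments.\<close>

lemma lattice_word_reverse_row_word_iff:
  assumes "finite S"
  shows "lattice_word (reverse_row_word S T) \<longleftrightarrow>
    (\<forall>D b. initial_segment S D \<and> 2 \<le> b \<longrightarrow>
       card {x \<in> D. T x = b} \<le> card {x \<in> D. T x = b - 1})"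
proof -
  have "(\<forall>n. P (set (take n (reading_order S)))) \<longleftrightarrow> (\<forall>D. initial_segment S D \<longrightarrow> P D)" for P
    using initial_segment_take[OF assms] by (auto elim: initial_segment_eq_take[OF assms])
  from this[of "\<lambda>D. \<forall>b\<ge>2. card {x \<in> D. T x = b} \<le> card {x \<in> D. T x = b - 1}"]
  show ?thesis
    unfolding lattice_word_def count_list_take_word by blast
qed


section \<open>Counting labels row by row\<close>

text \<open>The hypothesis bounds the labels \<open>Suc k\<close> in row \<open>r\<close> by the
  difference of the counts of \<open>k\<close> and \<open>Suc k\<close> above that row; these
  differences telescope.\<close>

lemma telescoped_row_le:
  fixes n :: "nat \<Rightarrow> nat \<Rightarrow> nat"
  assumes "\<And>k. 1 \<le> k \<Longrightarrow> (\<Sum>s<Suc r. n (Suc k) s) \<le> (\<Sum>s<r. n k s)" "1 \<le> m"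
  shows "(\<Sum>k\<in>{m<..K}. n k r) \<le> (\<Sum>s<r. n m s)"
proof (cases "m \<le> K")
  case True
  \<comment> \<open>The last term of the telescoping sum stays on the left so that the induction on
    \<open>K\<close> closes.\<close>
  then have "(\<Sum>k\<in>{m<..K}. n k r) + (\<Sum>s<r. n K s) \<le> (\<Sum>s<r. n m s)"
  proof (induction K rule: dec_induct)
    case (step K)
    have "{m<..Suc K} = insert (Suc K) {m<..K}"
      using step by auto
    then show ?case
      using step assms(1)[of K] assms(2) by simp
  qed simp
  then show ?thesis
    by simp
qed simp

text \<open>Rows of \<open>R\<close> are added from top to bottom. In a new row the labels up to
  \<open>i + card R\<close> are counted exactly; larger ones are absorbed by the labels
  \<open>i + card R\<close> in the rows above, which the bound for the other rows of
  \<open>R\<close> leaves untouched.\<close>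

lemma sum_rows_le:
  fixes n :: "nat \<Rightarrow> nat \<Rightarrow> nat"
  assumes lr: "\<And>k r. 1 \<le> k \<Longrightarrow> (\<Sum>s<Suc r. n (Suc k) s) \<le> (\<Sum>s<r. n k s)"
    and "R \<subseteq> {..<r}"
  shows "(\<Sum>s\<in>R. \<Sum>k\<in>{i<..K}. n k s) \<le> (\<Sum>k\<in>{i<..i + card R}. \<Sum>s<r. n k s)"
  using assms(2)
proof (induction r arbitrary: R)
  case (Suc r)
  have fin: "finite R"
    using Suc.prems finite_subset by blast
  show ?case
  proof (cases "r \<in> R")
    case True
    define R' where "R' = R - {r}"
    have R: "R = insert r R'" "r \<notin> R'" "finite R'"
      using True fin by (auto simp: R'_def)
    have "R' \<subseteq> {..<r}"
      using Suc.prems by (auto simp: R'_def less_Suc_eq)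
    note IH = Suc.IH[OF this]
    let ?m = "i + card R"
    have m: "?m = Suc (i + card R')"
      using R by simp
    \<comment> \<open>Only an inequality, since \<open>K\<close> may be smaller than
      \<open>?m\<close>.\<close>
    have "(\<Sum>k\<in>{i<..K}. n k r) \<le> (\<Sum>k\<in>{i<..?m} \<union> {?m<..K}. n k r)"
      by (intro sum_mono2) auto
    also have "\<dots> = (\<Sum>k\<in>{i<..?m}. n k r) + (\<Sum>k\<in>{?m<..K}. n k r)"
      by (rule sum.union_disjoint) auto
    also have "(\<Sum>k\<in>{?m<..K}. n k r) \<le> (\<Sum>s<r. n ?m s)"
      using m by (intro telescoped_row_le lr) auto
    finally have 1: "(\<Sum>k\<in>{i<..K}. n k r) \<le> (\<Sum>k\<in>{i<..?m}. n k r) + (\<Sum>s<r. n ?m s)"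
      by simp
    have "{i<..?m} = insert ?m {i<..i + card R'}" "?m \<notin> {i<..i + card R'}"
      using m by auto
    then have 2: "(\<Sum>k\<in>{i<..?m}. \<Sum>s<r. n k s) =
        (\<Sum>s<r. n ?m s) + (\<Sum>k\<in>{i<..i + card R'}. \<Sum>s<r. n k s)"
      by (metis finite_greaterThanAtMost sum.insert)
    have "(\<Sum>s\<in>R. \<Sum>k\<in>{i<..K}. n k s) =
        (\<Sum>k\<in>{i<..K}. n k r) + (\<Sum>s\<in>R'. \<Sum>k\<in>{i<..K}. n k s)"
      using R by simp
    also have "\<dots> \<le> (\<Sum>k\<in>{i<..?m}. n k r) + (\<Sum>k\<in>{i<..?m}. \<Sum>s<r. n k s)"
      using 1 2 IH by linarith
    finally show ?thesis
      by (simp add: sum.distrib add.commute)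
  next
    case False
    then have "R \<subseteq> {..<r}"
      using Suc.prems by (auto simp: less_Suc_eq)
    from Suc.IH[OF this] show ?thesis
      by (rule order_trans) (intro sum_mono, simp)
  qed
qed simp

section \<open>Sorted row lengths and their change from row to row\<close>

text \<open>For \<open>k \<ge> 1\<close> this is the \<open>k\<close>-th largest of the numbers \<open>\<rho> 0, \<dots>, \<rho> (r - 1)\<close>,
  obtained by conjugating twice.\<close>

definition kth_largest :: "(nat \<Rightarrow> nat) \<Rightarrow> nat \<Rightarrow> nat \<Rightarrow> nat" where
  "kth_largest \<rho> r k = card {c. 1 \<le> c \<and> k \<le> card {s. s < r \<and> c \<le> \<rho> s}}"

text \<open>For \<open>k \<ge> 1\<close> some row has to reach \<open>c\<close>, so
  \<open>c \<le> M\<close>. The finite range permits double counting.\<close>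

lemma kth_largest_bounded:
  assumes "1 \<le> k" "\<And>s. s < r \<Longrightarrow> \<rho> s \<le> M"
  shows "kth_largest \<rho> r k = card {c \<in> {1..M}. k \<le> card {s. s < r \<and> c \<le> \<rho> s}}"
proof -
  have "c \<le> M" if "k \<le> card {s. s < r \<and> c \<le> \<rho> s}" for c
  proof -
    have "{s. s < r \<and> c \<le> \<rho> s} \<noteq> {}"
      using that assms(1) by (metis card.empty not_one_le_zero le_zero_eq)
    then show ?thesis
      using assms(2) le_trans by blast
  qed
  then show ?thesis
    unfolding kth_largest_def by (intro arg_cong[where f=card]) auto
qed

lemma sum_card_swap:
  assumes "finite X" "finite Y"
  shows "(\<Sum>x\<in>X. card {y \<in> Y. P x y}) = (\<Sum>y\<in>Y. card {x \<in> X. P x y})"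
proof -
  have "(\<Sum>x\<in>X. card {y \<in> Y. P x y}) = (\<Sum>x\<in>X. \<Sum>y\<in>Y. if P x y then 1 else 0)"
    using assms by (simp add: sum.If_cases Int_def)
  also have "\<dots> = (\<Sum>y\<in>Y. \<Sum>x\<in>X. if P x y then 1 else 0)"
    by (rule sum.swap)
  also have "\<dots> = (\<Sum>y\<in>Y. card {x \<in> X. P x y})"
    using assms by (simp add: sum.If_cases Int_def)
  finally show ?thesis .
qed

text \<open>\<open>A\<close> consists of longest rows. Each \<open>c\<close> contributes to both
  sides the minimum of \<open>card A\<close> and the number of rows that reach
  \<open>c\<close>.\<close>

lemma sum_kth_largest:
  assumes A: "A \<subseteq> {..<r}" and top: "\<And>s t. s \<in> A \<Longrightarrow> t < r \<Longrightarrow> t \<notin> A \<Longrightarrow> \<rho> t \<le> \<rho> s"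
  shows "(\<Sum>k\<in>{0<..card A}. kth_largest \<rho> r k) = sum \<rho> A"
proof -
  have fin: "finite A"
    using A finite_subset by blast
  \<comment> \<open>The extra 0 keeps \<open>Max\<close> meaningful for
    \<open>r = 0\<close>.\<close>
  define M where "M = Max (insert 0 (\<rho> ` {..<r}))"
  have M: "\<rho> s \<le> M" if "s < r" for s
    using that unfolding M_def by (intro Max_ge) auto
  let ?g = "\<lambda>c. card {s. s < r \<and> c \<le> \<rho> s}"
  have g: "card {k \<in> {0<..card A}. k \<le> ?g c} = card {s \<in> A. c \<le> \<rho> s}" for c
  proof (cases "\<forall>s\<in>A. c \<le> \<rho> s")
    case True
    then have "card A \<le> ?g c"
      using A by (intro card_mono) auto
    then have "{k \<in> {0<..card A}. k \<le> ?g c} = {0<..card A}"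
      by auto
    moreover have "{s \<in> A. c \<le> \<rho> s} = A"
      using True by auto
    ultimately show ?thesis
      by simp
  next
    case False
    then obtain s where s: "s \<in> A" "\<rho> s < c"
      by auto
    \<comment> \<open>A row outside \<open>A\<close> is no longer than \<open>s\<close>, so it
      cannot reach \<open>c\<close> either.\<close>
    have eq: "{s. s < r \<and> c \<le> \<rho> s} = {s \<in> A. c \<le> \<rho> s}"
      using A top[OF s(1)] s(2) by fastforce
    have "card {s \<in> A. c \<le> \<rho> s} \<le> card A"
      using fin by (intro card_mono) auto
    then have "{k \<in> {0<..card A}. k \<le> ?g c} = {0<..card {s \<in> A. c \<le> \<rho> s}}"
      unfolding eq by auto
    then show ?thesis
      by simp
  qed
  have "(\<Sum>k\<in>{0<..card A}. kth_largest \<rho> r k) =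
      (\<Sum>k\<in>{0<..card A}. card {c \<in> {1..M}. k \<le> ?g c})"
    by (rule sum.cong[OF refl], rule kth_largest_bounded) (auto intro: M)
  also have "\<dots> = (\<Sum>c\<in>{1..M}. card {k \<in> {0<..card A}. k \<le> ?g c})"
    by (rule sum_card_swap) auto
  also have "\<dots> = (\<Sum>c\<in>{1..M}. card {s \<in> A. c \<le> \<rho> s})"
    unfolding g ..
  also have "\<dots> = (\<Sum>s\<in>A. card {c \<in> {1..M}. c \<le> \<rho> s})"
    using fin by (intro sum_card_swap) auto
  also have "\<dots> = sum \<rho> A"
  proof (rule sum.cong[OF refl])
    fix s assume "s \<in> A"
    then have "{c \<in> {1..M}. c \<le> \<rho> s} = {1..\<rho> s}"
      using M[of s] A by auto
    then show "card {c \<in> {1..M}. c \<le> \<rho> s} = \<rho> s"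
      by simp
  qed
  finally show ?thesis .
qed

lemma kth_largest_eq_0: "r < k \<Longrightarrow> kth_largest \<rho> r k = 0"
proof -
  assume "r < k"
  moreover have "card {s. s < r \<and> c \<le> \<rho> s} \<le> r" for c
    using card_mono[of "{..<r}" "{s. s < r \<and> c \<le> \<rho> s}"] by auto
  ultimately have "\<not> k \<le> card {s. s < r \<and> c \<le> \<rho> s}" for c
    by (meson le_trans not_le)
  then show ?thesis
    by (simp add: kth_largest_def)
qed

lemma card_rows_Suc:
  "card {s. s < Suc r \<and> c \<le> \<rho> s} =
     card {s. s < r \<and> c \<le> \<rho> s} + (if c \<le> \<rho> r then 1 else 0)"
proof -
  have "{s. s < Suc r \<and> c \<le> \<rho> s} =
      (if c \<le> \<rho> r then insert r {s. s < r \<and> c \<le> \<rho> s} else {s. s < r \<and> c \<le> \<rho> s})"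
    by (auto simp: less_Suc_eq)
  then show ?thesis
    by simp
qed

text \<open>Row \<open>r\<close> is inserted into the sorted lengths behind all strictly longer
  rows, so the parts before that position stay as they are.\<close>

lemma kth_largest_Suc_low:
  assumes "k \<le> card {s. s < r \<and> \<rho> r < \<rho> s}"
  shows "kth_largest \<rho> (Suc r) k = kth_largest \<rho> r k"
proof -
  have "k \<le> card {s. s < Suc r \<and> c \<le> \<rho> s} \<longleftrightarrow> k \<le> card {s. s < r \<and> c \<le> \<rho> s}" for c
  proof (cases "c \<le> \<rho> r")
    case True
    then have "card {s. s < r \<and> \<rho> r < \<rho> s} \<le> card {s. s < r \<and> c \<le> \<rho> s}"
      by (intro card_mono) auto
    then show ?thesis
      using assms by (simp add: card_rows_Suc)
  qed (simp add: card_rows_Suc)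
  then show ?thesis
    by (simp add: kth_largest_def)
qed

text \<open>Parts behind the insertion point of row \<open>r\<close> move down by one
  position.\<close>

lemma kth_largest_Suc_high:
  assumes "card {s. s < r \<and> \<rho> r < \<rho> s} < k"
  shows "kth_largest \<rho> (Suc r) (Suc k) = kth_largest \<rho> r k"
proof -
  have "Suc k \<le> card {s. s < Suc r \<and> c \<le> \<rho> s} \<longleftrightarrow> k \<le> card {s. s < r \<and> c \<le> \<rho> s}" for c
  proof (cases "c \<le> \<rho> r")
    case False
    then have "card {s. s < r \<and> c \<le> \<rho> s} \<le> card {s. s < r \<and> \<rho> r < \<rho> s}"
      by (intro card_mono) auto
    then show ?thesis
      using assms False by (simp add: card_rows_Suc)
  qed (simp add: card_rows_Suc)
  then show ?thesis
    by (simp add: kth_largest_def)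
qed

text \<open>The labels up to row \<open>r\<close> form a partition that interlaces with the one up to row \<open>r - 1\<close>
  and still dominates the sorted row lengths; together with the sizes this leaves only one
  choice, namely removing a part equal to the length of row \<open>r\<close>.\<close>

lemma label_counts_step:
  fixes n :: "nat \<Rightarrow> nat \<Rightarrow> nat"
  assumes lr: "\<And>k r. 1 \<le> k \<Longrightarrow> (\<Sum>s<Suc r. n (Suc k) s) \<le> (\<Sum>s<r. n k s)"
    and \<rho>: "\<And>s. \<rho> s = (\<Sum>k\<in>{0<..K}. n k s)"
    and big: "\<And>k s. K < k \<Longrightarrow> n k s = 0" and "r \<le> K"
    and eq: "\<And>k. 1 \<le> k \<Longrightarrow> (\<Sum>s<Suc r. n k s) = kth_largest \<rho> (Suc r) k"
    and "1 \<le> k"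
  shows "(\<Sum>s<r. n k s) = kth_largest \<rho> r k"
proof -
  let ?N = "\<lambda>k. \<Sum>s<r. n k s" and ?q = "kth_largest \<rho> r"
  define R where "R = {s. s < r \<and> \<rho> r < \<rho> s}"
  have low_le: "?N k \<le> ?q k" if "k \<in> {0<..card R}" for k
  proof -
    have "?N k \<le> (\<Sum>s<Suc r. n k s)"
      by simp
    also have "\<dots> = ?q k"
      using that eq[of k] kth_largest_Suc_low[of k r \<rho>] by (simp add: R_def)
    finally show ?thesis .
  qed
  \<comment> \<open>The rows longer than row \<open>r\<close> supply the first \<open>card R\<close>
    parts. The row bound with \<open>i = 0\<close> opposes \<open>low_le\<close> on the totals,
    which forces equality part by part.\<close>
  have "(\<Sum>k\<in>{0<..card R}. ?q k) = sum \<rho> R"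
    by (rule sum_kth_largest) (auto simp: R_def)
  also have "\<dots> \<le> (\<Sum>k\<in>{0<..card R}. ?N k)"
    using sum_rows_le[of n R r 0 K, OF lr] by (auto simp: R_def \<rho>)
  finally have low: "?N k = ?q k" if "k \<in> {0<..card R}" for k
    using low_le that sum_mono[of "{0<..card R}" ?N ?q, OF low_le]
    by (intro sum_mono_inv[of ?N "{0<..card R}" ?q]) auto
  \<comment> \<open>Beyond \<open>card R\<close>, \<open>?q k\<close> is part \<open>Suc k\<close>
    of the sorted lengths that include row \<open>r\<close>, and the lattice condition bounds that
    part.\<close>
  have ge: "?q k \<le> ?N k" if "1 \<le> k" for k
  proof (cases "k \<le> card R")
    case True
    then show ?thesis
      using low[of k] that by simp
  next
    case False
    then have "?q k = kth_largest \<rho> (Suc r) (Suc k)"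
      using kth_largest_Suc_high[of r \<rho> k] by (simp add: R_def)
    also have "\<dots> \<le> ?N k"
      using eq[of "Suc k"] lr[OF that, of r] by simp
    finally show ?thesis .
  qed
  \<comment> \<open>Both families have the same total, so the termwise bound \<open>ge\<close> must
    be an equality. By \<open>r \<le> K\<close> no nonzero \<open>?q k\<close> lies outside the
    range.\<close>
  have "(\<Sum>k\<in>{0<..K}. ?q k) = (\<Sum>k\<in>{0<..r}. ?q k)"
    using \<open>r \<le> K\<close> by (intro sum.mono_neutral_right) (auto intro: kth_largest_eq_0)
  also have "\<dots> = sum \<rho> {..<r}"
    using sum_kth_largest[of "{..<r}" r \<rho>] by simp
  also have "\<dots> = (\<Sum>k\<in>{0<..K}. ?N k)"
    unfolding \<rho> by (rule sum.swap)
  finally have "?q k = ?N k" if "k \<in> {0<..K}"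
    using that ge by (intro sum_mono_inv[of ?q "{0<..K}" ?N]) auto
  moreover have "?q k = ?N k" if "K < k"
    using that \<open>r \<le> K\<close> by (simp add: big kth_largest_eq_0)
  ultimately show ?thesis
    using \<open>1 \<le> k\<close> by (cases "k \<le> K") auto
qed

text \<open>Downward induction starting from the totals over all \<open>L\<close> rows, which the
  content of a tableau will supply.\<close>

lemma label_counts_eq:
  fixes n :: "nat \<Rightarrow> nat \<Rightarrow> nat"
  assumes lr: "\<And>k r. 1 \<le> k \<Longrightarrow> (\<Sum>s<Suc r. n (Suc k) s) \<le> (\<Sum>s<r. n k s)"
    and \<rho>: "\<And>s. \<rho> s = (\<Sum>k\<in>{0<..K}. n k s)"
    and big: "\<And>k s. K < k \<Longrightarrow> n k s = 0" and "L \<le> K"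
    and eq: "\<And>k. 1 \<le> k \<Longrightarrow> (\<Sum>s<L. n k s) = kth_largest \<rho> L k"
    and "r \<le> L" "1 \<le> k"
  shows "(\<Sum>s<r. n k s) = kth_largest \<rho> r k"
  using \<open>r \<le> L\<close> \<open>1 \<le> k\<close>
proof (induction r arbitrary: k rule: inc_induct)
  case base
  then show ?case
    by (rule eq)
next
  case (step r)
  show ?case
    by (rule label_counts_step[where K=K, OF lr \<rho> big _ step.IH])
      (use step \<open>L \<le> K\<close> in auto)
qed


section \<open>Row partitions\<close>

lemma sorted_wrt_ge_rev_sort: "sorted_wrt (\<ge>) (rev (sort (xs :: nat list)))"
  by (simp add: sorted_wrt_rev)

lemma map_sort_key: "map f (sort_key f xs) = sort (map f xs)"
  by (rule properties_for_sort[symmetric]) auto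

text \<open>Sorting the indices by their values, rather than the values alone, keeps track of which
  rows supply the first \<open>j\<close> parts.\<close>

lemma sum_list_take_rev_sort:
  fixes f :: "'a \<Rightarrow> nat"
  assumes "distinct xs" "j \<le> length xs"
  obtains R where "R \<subseteq> set xs" "card R = j" "sum_list (take j (rev (sort (map f xs)))) = sum f R"
proof
  let ?ys = "rev (sort_key f xs)"
  have d: "distinct (take j ?ys)"
    using assms(1) by simp
  show "set (take j ?ys) \<subseteq> set xs"
    using set_take_subset[of j ?ys] by simp
  show "card (set (take j ?ys)) = j"
    using distinct_card[OF d] assms(2) by simp
  have "rev (sort (map f xs)) = map f ?ys"
    by (simp add: map_sort_key[symmetric] rev_map)
  then show "sum_list (take j (rev (sort (map f xs)))) = sum f (set (take j ?ys))"
    using sum_list_distinct_conv_sum_set[OF d, of f] by (simp add: take_map)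
qed

lemma is_partition_row_partition:
  assumes "finite S"
  shows "is_partition (row_partition S)"
proof -
  have "0 < card {j. (i, j) \<in> S}" if "i \<in> fst ` S" for i
    using that finite_row[OF assms, of i] by (auto simp: card_gt_0_iff)
  then show ?thesis
    using assms by (auto simp: is_partition_def row_partition_def sorted_wrt_rev)
qed

lemma sum_list_row_partition:
  assumes "finite S"
  shows "sum_list (row_partition S) = card S"
proof -
  have "mset (row_partition S) =
      mset (map (\<lambda>i. card {j. (i, j) \<in> S}) (sorted_list_of_set (fst ` S)))"
    by (simp add: row_partition_def)
  then have "sum_list (row_partition S) =
      sum_list (map (\<lambda>i. card {j. (i, j) \<in> S}) (sorted_list_of_set (fst ` S)))"
    by (metis sum_mset_sum_list)
  also have "\<dots> = (\<Sum>i\<in>fst ` S. card {j. (i, j) \<in> S})"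
    using assms by (simp add: sum_list_distinct_conv_sum_set)
  also have "\<dots> = card (Sigma (fst ` S) (\<lambda>i. {j. (i, j) \<in> S}))"
    by (rule card_SigmaI[symmetric]) (simp_all add: assms finite_row)
  also have "Sigma (fst ` S) (\<lambda>i. {j. (i, j) \<in> S}) = S"
    by force
  finally show ?thesis .
qed

text \<open>In a decreasing list the entries that are at least \<open>c\<close> form a prefix; this
  is the passage to the conjugate partition.\<close>

lemma le_part_iff_length_filter:
  assumes "sorted_wrt (\<ge>) (p :: nat list)" "1 \<le> k" "1 \<le> c"
  shows "c \<le> part p k \<longleftrightarrow> k \<le> length (filter (\<lambda>x. c \<le> x) p)"
  using assms
proof (induction p arbitrary: k)
  case Nil
  then show ?case
    by (simp add: part_def)
next
  case (Cons a p)
  show ?case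
  proof (cases "k = 1")
    case True
    have "c \<le> a" if "filter (\<lambda>x. c \<le> x) p \<noteq> []"
      using that Cons.prems(1) by (fastforce simp: filter_empty_conv)
    then show ?thesis
      using True by (auto simp: part_def Suc_le_eq)
  next
    case False
    then obtain m where k: "k = Suc m" "1 \<le> m"
      using Cons.prems(2) by (cases k) auto
    have "part (a # p) k = part p m"
      using k by (auto simp: part_def nth_Cons')
    moreover have "filter (\<lambda>x. c \<le> x) p = []" if "a < c"
      using that Cons.prems(1) by (fastforce simp: filter_empty_conv)
    ultimately show ?thesis
      using Cons.IH[of m] Cons.prems k by auto
  qed
qed

text \<open>Both sides count the \<open>c \<ge> 1\<close> that are reached by at least
  \<open>k\<close> rows.\<close>

lemma part_row_partition:
  assumes "finite S" "fst ` S \<subseteq> {..<L}" "1 \<le> k"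
  shows "part (row_partition S) k = kth_largest (\<lambda>s. card {j. (s, j) \<in> S}) L k"
proof -
  let ?\<rho> = "\<lambda>s. card {j. (s, j) \<in> S}"
  have "c \<le> part (row_partition S) k \<longleftrightarrow> k \<le> card {s. s < L \<and> c \<le> ?\<rho> s}" if c: "1 \<le> c" for c
  proof -
    let ?xs = "sorted_list_of_set (fst ` S)"
    have "c \<le> part (row_partition S) k \<longleftrightarrow>
        k \<le> length (filter (\<lambda>x. c \<le> x) (row_partition S))"
      unfolding row_partition_def
      by (rule le_part_iff_length_filter[OF sorted_wrt_ge_rev_sort assms(3) c])
    also have "length (filter (\<lambda>x. c \<le> x) (row_partition S)) =
        length (filter (\<lambda>x. c \<le> x) (map ?\<rho> ?xs))"
      by (rule mset_eq_length) (simp add: row_partition_def)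
    also have "\<dots> = length (filter (\<lambda>s. c \<le> ?\<rho> s) ?xs)"
      by (simp add: filter_map comp_def)
    also have "\<dots> = card (set (filter (\<lambda>s. c \<le> ?\<rho> s) ?xs))"
      by (rule distinct_card[symmetric]) simp
    also have "set (filter (\<lambda>s. c \<le> ?\<rho> s) ?xs) = {s. s < L \<and> c \<le> ?\<rho> s}"
    proof -
      \<comment> \<open>\<open>1 \<le> c\<close> excludes the empty rows below \<open>L\<close>,
        which \<open>row_partition\<close> does not list.\<close>
      have "s \<in> fst ` S" if "c \<le> ?\<rho> s" for s
      proof -
        have "{j. (s, j) \<in> S} \<noteq> {}"
          using that c by (metis card.empty not_one_le_zero le_zero_eq)
        then show ?thesis
          by force
      qed
      then show ?thesis
        using assms(1,2) by auto
    qed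
    finally show ?thesis .
  qed
  then have "{c. 1 \<le> c \<and> k \<le> card {s. s < L \<and> c \<le> ?\<rho> s}} = {1..part (row_partition S) k}"
    by auto
  then show ?thesis
    by (simp add: kth_largest_def)
qed


section \<open>Tableaux\<close>

text \<open>The matrix \<open>n\<close> of the counting lemmas, label first and row second.\<close>

definition row_count :: "(nat \<times> nat) set \<Rightarrow> (nat \<times> nat \<Rightarrow> nat) \<Rightarrow> nat \<Rightarrow> nat \<Rightarrow> nat" where
  "row_count S T k s = card {j. (s, j) \<in> S \<and> T (s, j) = k}"

lemma sum_card_rows:
  assumes "finite S" "finite R"
  shows "(\<Sum>s\<in>R. card {j. (s, j) \<in> S \<and> P (s, j)}) = card {x \<in> S. fst x \<in> R \<and> P x}"
proof -
  have "(\<Sum>s\<in>R. card {j. (s, j) \<in> S \<and> P (s, j)}) =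
      card (Sigma R (\<lambda>s. {j. (s, j) \<in> S \<and> P (s, j)}))"
    using assms by (simp add: finite_row_Collect)
  also have "Sigma R (\<lambda>s. {j. (s, j) \<in> S \<and> P (s, j)}) = {x \<in> S. fst x \<in> R \<and> P x}"
    by auto
  finally show ?thesis .
qed

lemma sum_row_count:
  "finite S \<Longrightarrow> (\<Sum>s<r. row_count S T k s) = card {x \<in> S. fst x < r \<and> T x = k}"
  unfolding row_count_def using sum_card_rows[of S "{..<r}" "\<lambda>x. T x = k"] by simp

lemma sum_row_count_labels:
  assumes "finite S"
  shows "(\<Sum>k\<in>{i<..K}. row_count S T k s) =
    card {j. (s, j) \<in> S \<and> i < T (s, j) \<and> T (s, j) \<le> K}"
proof -
  have "(\<Sum>k\<in>{i<..K}. row_count S T k s) =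
      card (\<Union>k\<in>{i<..K}. {j. (s, j) \<in> S \<and> T (s, j) = k})"
    unfolding row_count_def
    by (rule card_UN_disjoint[symmetric]) (auto simp: finite_row_Collect[OF assms])
  also have "(\<Union>k\<in>{i<..K}. {j. (s, j) \<in> S \<and> T (s, j) = k}) =
      {j. (s, j) \<in> S \<and> i < T (s, j) \<and> T (s, j) \<le> K}"
    by auto
  finally show ?thesis .
qed

lemma sum_card_labels:
  fixes T :: "'a \<Rightarrow> nat"
  assumes "finite S"
  shows "(\<Sum>k\<in>{i<..K}. card {x \<in> S. T x = k}) = card {x \<in> S. i < T x \<and> T x \<le> K}"
proof -
  have "(\<Sum>k\<in>{i<..K}. card {x \<in> S. T x = k}) = card (\<Union>k\<in>{i<..K}. {x \<in> S. T x = k})"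
    by (rule card_UN_disjoint[symmetric]) (auto simp: assms)
  also have "(\<Union>k\<in>{i<..K}. {x \<in> S. T x = k}) = {x \<in> S. i < T x \<and> T x \<le> K}"
    by auto
  finally show ?thesis .
qed

text \<open>Row \<open>r\<close> is read from the right and its labels decrease weakly on the way,
  so reading can stop after its last label \<open>\<ge> Suc k\<close> and before any
  \<open>k\<close> in it. \<open>D\<close> is the set of cells read by then.\<close>

lemma lattice_row_counts:
  assumes S: "finite S" and ss: "semistandard S T"
    and lat: "lattice_word (reverse_row_word S T)" and k: "1 \<le> k"
  shows "(\<Sum>s<Suc r. row_count S T (Suc k) s) \<le> (\<Sum>s<r. row_count S T k s)"
proof -
  define D where "D = {x \<in> S. fst x < r \<or> fst x = r \<and> Suc k \<le> T x}"
  have inc: "T (i, j) \<le> T (i, j')" if "(i, j) \<in> S" "(i, j') \<in> S" "j < j'" for i j j'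
    using ss that unfolding semistandard_def by blast
  have "y \<in> D" if "x \<in> D" "y \<in> S" "read_before y x" for x y
  proof (cases "fst y < r")
    case False
    then have *: "fst x = r" "fst y = r" "snd x < snd y" "Suc k \<le> T x"
      using that by (auto simp: D_def read_before_def)
    have "x = (r, snd x)" "y = (r, snd y)" "x \<in> S"
      using that * by (auto simp: D_def prod_eq_iff)
    then have "T x \<le> T y"
      using inc[of r "snd x" "snd y"] that(2) *(3) by simp
    then show ?thesis
      using that * by (simp add: D_def)
  qed (use that in \<open>simp add: D_def\<close>)
  then have "initial_segment S D"
    by (auto simp: initial_segment_def D_def)
  then have "card {x \<in> D. T x = Suc k} \<le> card {x \<in> D. T x = Suc k - 1}"
    using lat k unfolding lattice_word_reverse_row_word_iff[OF S]
    by (elim allE[of _ D] allE[of _ "Suc k"]) simp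
  moreover have "{x \<in> D. T x = Suc k} = {x \<in> S. fst x < Suc r \<and> T x = Suc k}"
    by (auto simp: D_def)
  moreover have "{x \<in> D. T x = Suc k - 1} = {x \<in> S. fst x < r \<and> T x = k}"
    by (auto simp: D_def)
  ultimately show ?thesis
    by (simp only: sum_row_count[OF S])
qed

section \<open>Labels of surviving cells and the dominance bounds\<close>

lemma label_le_length:
  assumes S: "finite S" and ss: "semistandard S T" and content: "has_content S T \<mu>"
    and x: "x \<in> S"
  shows "T x \<le> length \<mu>"
proof (rule ccontr)
  assume "\<not> T x \<le> length \<mu>"
  then have "card {y \<in> S. T y = T x} = 0"
    using content unfolding has_content_def part_def by auto
  moreover have "finite {y \<in> S. T y = T x}"
    using S by simp
  ultimately show False
    using x by (metis (mono_tags, lifting) card_0_eq empty_Collect_eq)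
qed

lemma label_ge_1: "semistandard S T \<Longrightarrow> x \<in> S \<Longrightarrow> 1 \<le> T x"
  unfolding semistandard_def by auto

text \<open>The labels above the cell in its column are distinct, positive and smaller than its own,
  so there are at most \<open>T x - 1\<close> of them.\<close>

lemma delete_top_label:
  assumes S: "finite S" and ss: "semistandard S T" and x: "x \<in> delete_top i S"
  shows "i < T x"
proof -
  obtain r c where x: "x = (r, c)" "(r, c) \<in> S" "i \<le> card {r'. r' < r \<and> (r', c) \<in> S}"
    using assms(3) by (auto simp: delete_top_def)
  let ?A = "{r'. r' < r \<and> (r', c) \<in> S}"
  have col: "T (s, c) < T (s', c)" if "(s, c) \<in> S" "(s', c) \<in> S" "s < s'" for s s'
    using ss that unfolding semistandard_def by blast
  have "inj_on (\<lambda>s. T (s, c)) ?A"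
  proof (rule inj_onI)
    fix s s' assume "s \<in> ?A" "s' \<in> ?A" "T (s, c) = T (s', c)"
    then show "s = s'"
      using col[of s s'] col[of s' s] by (cases s s' rule: linorder_cases) auto
  qed
  moreover have "(\<lambda>s. T (s, c)) ` ?A \<subseteq> {1..<T (r, c)}"
    using col x label_ge_1[OF ss] by auto
  ultimately have "card ?A \<le> card {1..<T (r, c)}"
    by (intro card_inj_on_le) auto
  moreover have "1 \<le> T (r, c)"
    using label_ge_1[OF ss] x by blast
  ultimately show ?thesis
    using x by simp
qed

lemma sum_list_take_drop_part:
  "(\<Sum>k\<in>{i<..i + j}. part \<mu> k) = sum_list (take j (drop i \<mu>))"
proof (induction j)
  case (Suc j)
  have "{i<..i + Suc j} = insert (i + Suc j) {i<..i + j}"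
    by auto
  moreover have "sum_list (take (Suc j) (drop i \<mu>)) =
      sum_list (take j (drop i \<mu>)) + part \<mu> (i + Suc j)"
    by (cases "i + j < length \<mu>") (auto simp: take_Suc_conv_app_nth part_def)
  ultimately show ?case
    using Suc by simp
qed simp

lemma lower_deriv_eq: "lower_deriv i S = row_partition (delete_top i S)"
proof -
  have "delete_top 0 S = S"
    by (auto simp: delete_top_def)
  then show ?thesis
    by (simp add: lower_deriv_def)
qed

text \<open>Surviving cells have labels above \<open>i\<close>, so \<open>sum_rows_le\<close> bounds
  any \<open>j\<close> rows of them. The case \<open>i = 0\<close> is included because it yields the
  minimality.\<close>

lemma lower_deriv_le_drop:
  assumes S: "finite S" and ss: "semistandard S T" and content: "has_content S T \<mu>"
    and lat: "lattice_word (reverse_row_word S T)"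
  shows "lower_deriv i S \<le>\<^sub>G drop i \<mu>"
proof -
  let ?D = "delete_top i S"
  have D: "?D \<subseteq> S" "finite ?D"
    using S by (auto simp: delete_top_def intro: finite_subset[OF _ S])
  have count: "card {x \<in> S. T x = k} = part \<mu> k" if "1 \<le> k" for k
    using content that unfolding has_content_def by blast
  obtain L where L: "fst ` S \<subseteq> {..<L}"
    using S finite_nat_set_iff_bounded[of "fst ` S"] by auto
  \<comment> \<open>First the comparison of sizes that is part of \<open>gdom_le\<close>.\<close>
  have "sum_list (lower_deriv i S) = card ?D"
    by (simp add: lower_deriv_eq sum_list_row_partition D)
  also have "\<dots> \<le> card {x \<in> S. i < T x \<and> T x \<le> i + length (drop i \<mu>)}"
    using D S delete_top_label[OF S ss] label_le_length[OF S ss content]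
    by (intro card_mono) fastforce+
  also have "\<dots> = (\<Sum>k\<in>{i<..i + length (drop i \<mu>)}. part \<mu> k)"
    unfolding sum_card_labels[OF S, symmetric] by (rule sum.cong) (auto simp: count)
  also have "\<dots> = sum_list (drop i \<mu>)"
    unfolding sum_list_take_drop_part by simp
  finally have total: "sum_list (lower_deriv i S) \<le> sum_list (drop i \<mu>)" .
  have "sum_list (take j (lower_deriv i S)) \<le> sum_list (take j (drop i \<mu>))"
    if j: "j \<le> length (lower_deriv i S)" for j
  proof -
    let ?rows = "sorted_list_of_set (fst ` ?D)"
    have "j \<le> length ?rows"
      using j by (simp add: lower_deriv_eq row_partition_def)
    \<comment> \<open>\<open>R\<close> consists of \<open>j\<close> rows whose surviving cells
      realize the first \<open>j\<close> parts of the derivation.\<close>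
    then obtain R where R: "R \<subseteq> set ?rows" "card R = j"
      "sum_list (take j (lower_deriv i S)) = (\<Sum>s\<in>R. card {c. (s, c) \<in> ?D})"
      unfolding lower_deriv_eq row_partition_def
      by (rule sum_list_take_rev_sort[OF distinct_sorted_list_of_set])
    have "R \<subseteq> {..<L}"
      using R(1) D L by (auto dest!: subsetD)
    note R(3)
    also have "(\<Sum>s\<in>R. card {c. (s, c) \<in> ?D}) \<le>
        (\<Sum>s\<in>R. \<Sum>k\<in>{i<..length \<mu>}. row_count S T k s)"
      unfolding sum_row_count_labels[OF S]
      using D(1) delete_top_label[OF S ss] label_le_length[OF S ss content]
      by (intro sum_mono card_mono) (auto intro: finite_row_Collect[OF S])
    also have "\<dots> \<le> (\<Sum>k\<in>{i<..i + card R}. \<Sum>s<L. row_count S T k s)"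
      by (rule sum_rows_le[where n="row_count S T", OF lattice_row_counts[OF S ss lat] \<open>R \<subseteq> {..<L}\<close>])
    also have "\<dots> = (\<Sum>k\<in>{i<..i + j}. part \<mu> k)"
    proof (rule sum.cong)
      fix k assume "k \<in> {i<..i + j}"
      moreover have "{x \<in> S. fst x < L \<and> T x = k} = {x \<in> S. T x = k}"
        using L by auto
      ultimately show "(\<Sum>s<L. row_count S T k s) = part \<mu> k"
        by (simp add: sum_row_count[OF S] count)
    qed (simp add: R(2))
    finally show ?thesis
      by (simp only: sum_list_take_drop_part)
  qed
  with total show ?thesis
    by (simp add: gdom_le_def)
qed

section \<open>Uniqueness of the tableau of minimal content\<close>

text \<open>A weakly increasing filling of a row is the sorted list of its multiset of
  labels.\<close>

lemma mono_fun_eqI: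
  fixes f g :: "nat \<Rightarrow> nat"
  assumes A: "finite A"
    and f: "\<And>j j'. j \<in> A \<Longrightarrow> j' \<in> A \<Longrightarrow> j < j' \<Longrightarrow> f j \<le> f j'"
    and g: "\<And>j j'. j \<in> A \<Longrightarrow> j' \<in> A \<Longrightarrow> j < j' \<Longrightarrow> g j \<le> g j'"
    and eq: "\<And>k. card {j \<in> A. f j = k} = card {j \<in> A. g j = k}"
    and "j \<in> A"
  shows "f j = g j"
proof -
  let ?xs = "sorted_list_of_set A"
  have sorted: "sorted (map h ?xs)"
    if "\<And>j j'. j \<in> A \<Longrightarrow> j' \<in> A \<Longrightarrow> j < j' \<Longrightarrow> h j \<le> h j'" for h :: "nat \<Rightarrow> nat"
    unfolding sorted_map
    by (rule sorted_wrt_mono_rel[OF _ strict_sorted_list_of_set]) (use A that in auto)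
  have "mset (map f ?xs) = mset (map g ?xs)"
    by (rule multiset_eqI)
      (simp only: count_mset count_list_map_distinct distinct_sorted_list_of_set
        set_sorted_list_of_set[OF A] eq)
  then have "map f ?xs = map g ?xs"
    using sorted[of f, OF f] sorted[of g, OF g] by (metis properties_for_sort)
  then show ?thesis
    using \<open>j \<in> A\<close> A by simp
qed

text \<open>The content forces the accumulated counts, their differences are the counts in single
  rows, and these determine each row.\<close>

lemma lr_tableau_unique:
  assumes S: "finite S"
    and T: "semistandard S T" "has_content S T (row_partition S)"
      "lattice_word (reverse_row_word S T)"
    and U: "semistandard S U" "has_content S U (row_partition S)"
      "lattice_word (reverse_row_word S U)"
  shows "T = U"
proof -
  let ?\<mu> = "row_partition S" and ?\<rho> = "\<lambda>s. card {j. (s, j) \<in> S}"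
  obtain L where L: "fst ` S \<subseteq> {..<L}"
    using S finite_nat_set_iff_bounded[of "fst ` S"] by auto
  \<comment> \<open>\<open>K\<close> bounds the labels and also the rows, as
    \<open>label_counts_eq\<close> demands \<open>L \<le> K\<close>.\<close>
  define K where "K = max (length ?\<mu>) L"
  have counts: "(\<Sum>s<r. row_count S V k s) = kth_largest ?\<rho> r k"
    if V: "semistandard S V" "has_content S V ?\<mu>" "lattice_word (reverse_row_word S V)"
      and rk: "r \<le> L" "1 \<le> k" for V r k
  proof (rule label_counts_eq[where K=K and L=L])
    have le: "V x \<le> K" if "x \<in> S" for x
      using label_le_length[OF S V(1,2) that] by (simp add: K_def)
    show "?\<rho> s = (\<Sum>k\<in>{0<..K}. row_count S V k s)" for s
    proof -
      have "{j. (s, j) \<in> S} = {j. (s, j) \<in> S \<and> 0 < V (s, j) \<and> V (s, j) \<le> K}"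
        using le label_ge_1[OF V(1)] by (auto simp: Suc_le_eq)
      then show ?thesis
        by (simp add: sum_row_count_labels[OF S])
    qed
    show "row_count S V k s = 0" if "K < k" for k s
    proof -
      have "{j. (s, j) \<in> S \<and> V (s, j) = k} = {}"
        using le that by fastforce
      then show ?thesis
        by (simp only: row_count_def card.empty)
    qed
    show "(\<Sum>s<L. row_count S V k s) = kth_largest ?\<rho> L k" if "1 \<le> k" for k
    proof -
      have "{x \<in> S. fst x < L \<and> V x = k} = {x \<in> S. V x = k}"
        using L by auto
      then show ?thesis
        using V(2) that
        by (simp add: sum_row_count[OF S] part_row_partition[OF S L that, symmetric]
            has_content_def)
    qed
    show "(\<Sum>s<Suc r. row_count S V (Suc k) s) \<le> (\<Sum>s<r. row_count S V k s)"
      if "1 \<le> k" for k r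
      by (rule lattice_row_counts[OF S V(1,3) that])
  qed (use rk in \<open>simp_all add: K_def\<close>)
  have row: "row_count S T k s = row_count S U k s" if "s < L" for k s
  proof (cases "1 \<le> k")
    case True
    show ?thesis
      using counts[OF T _ True, of s] counts[OF T _ True, of "Suc s"]
        counts[OF U _ True, of s] counts[OF U _ True, of "Suc s"] that by simp
  next
    case False
    \<comment> \<open>The accumulated counts cover only \<open>k \<ge> 1\<close>; the label 0 never
      occurs.\<close>
    then have "{j. (s, j) \<in> S \<and> V (s, j) = k} = {}" if "semistandard S V" for V
      using label_ge_1[OF that] by blast
    then have "row_count S V k s = 0" if "semistandard S V" for V
      unfolding row_count_def using that by (simp only: card.empty)
    then show ?thesis
      using T U by simp
  qed
  show ?thesis
  proof (rule extensionalityI[of _ S])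
    fix x assume x: "x \<in> S"
    obtain i j where ij: "x = (i, j)"
      by (cases x)
    have "i < L"
      using x ij L by auto
    have inc: "V (i, j) \<le> V (i, j')"
      if "semistandard S V" "(i, j) \<in> S" "(i, j') \<in> S" "j < j'" for V j j'
      using that unfolding semistandard_def by blast
    have "T (i, j) = U (i, j)"
    proof (rule mono_fun_eqI[OF finite_row[OF S, of i], of "\<lambda>j. T (i, j)" "\<lambda>j. U (i, j)"])
      show "card {j \<in> {j. (i, j) \<in> S}. T (i, j) = k} = card {j \<in> {j. (i, j) \<in> S}. U (i, j) = k}"
        for k
        using row[OF \<open>i < L\<close>, of k] by (simp only: row_count_def mem_Collect_eq)
    qed (use inc[OF T(1)] inc[OF U(1)] x ij in simp_all)
    then show "T x = U x"
      by (simp add: ij)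
  qed (use T(1) U(1) in \<open>auto simp: semistandard_def PiE_def\<close>)
qed


section \<open>The tableau of minimal content\<close>

lemma part_antimono: "is_partition p \<Longrightarrow> 1 \<le> i \<Longrightarrow> i \<le> j \<Longrightarrow> part p j \<le> part p i"
  by (cases "i = j")
    (auto simp: part_def is_partition_def sorted_wrt_iff_nth_less)

lemma finite_skew_shape: "is_partition \<gamma> \<Longrightarrow> finite (skew_shape \<gamma> lam)"
proof -
  assume \<gamma>: "is_partition \<gamma>"
  have "skew_shape \<gamma> lam \<subseteq> {..length \<gamma>} \<times> {..part \<gamma> 1}"
  proof (clarsimp simp: skew_shape_def)
    fix i j assume "Suc 0 \<le> i" "part lam i < j" "j \<le> part \<gamma> i"
    then show "i \<le> length \<gamma> \<and> j \<le> part \<gamma> (Suc 0)"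
      using part_antimono[OF \<gamma>, of 1 i] by (auto simp: part_def split: if_splits)
  qed
  then show ?thesis
    by (rule finite_subset) simp
qed

text \<open>Removing maxima until \<open>k\<close> elements remain leaves the one of rank
  \<open>k\<close> on top.\<close>

lemma exists_kth_element:
  fixes A :: "nat set"
  assumes "finite A" "1 \<le> k" "k \<le> card A"
  shows "\<exists>r\<in>A. card {s \<in> A. s \<le> r} = k"
  using assms
proof (induction A rule: finite_linorder_max_induct)
  case (insert b A)
  have b: "b \<notin> A"
    using insert by auto
  show ?case
  proof (cases "k \<le> card A")
    case True
    then obtain r where r: "r \<in> A" "card {s \<in> A. s \<le> r} = k"
      using insert by auto
    then have "{s \<in> insert b A. s \<le> r} = {s \<in> A. s \<le> r}"
      using insert by (auto simp: not_le)
    then show ?thesis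
      using r by (intro bexI[of _ r]) auto
  next
    case False
    then have "k = card (insert b A)"
      using insert b by simp
    moreover have "{s \<in> insert b A. s \<le> b} = insert b A"
      using insert by auto
    ultimately show ?thesis
      by (intro bexI[of _ b]) auto
  qed
qed simp

text \<open>Push all rows to the right, so that the cell in column \<open>j\<close> of row \<open>r\<close> is in position
  \<open>c = part \<gamma> r + 1 - j\<close> from the right, and number the cells with the same \<open>c\<close> downwards.\<close>

definition long_rows :: "nat list \<Rightarrow> nat list \<Rightarrow> nat \<Rightarrow> nat set" where
  "long_rows \<gamma> lam c = {s. 1 \<le> s \<and> c \<le> part \<gamma> s - part lam s}"

definition min_tableau :: "nat list \<Rightarrow> nat list \<Rightarrow> nat \<times> nat \<Rightarrow> nat" where
  "min_tableau \<gamma> lam = restrict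
     (\<lambda>(r, j). card {s \<in> long_rows \<gamma> lam (part \<gamma> r + 1 - j). s \<le> r}) (skew_shape \<gamma> lam)"

lemma finite_long_rows: "1 \<le> c \<Longrightarrow> finite (long_rows \<gamma> lam c)"
  by (rule finite_subset[of _ "{..length \<gamma>}"])
    (auto simp: long_rows_def part_def split: if_splits)

lemma card_upto_strict_mono:
  fixes A B :: "nat set"
  assumes "finite B" "A \<subseteq> B" "r < r'" "r' \<in> B"
  shows "card {s \<in> A. s \<le> r} < card {s \<in> B. s \<le> r'}"
proof (rule psubset_card_mono)
  show "{s \<in> A. s \<le> r} \<subset> {s \<in> B. s \<le> r'}"
    using assms by force
qed (use assms in simp)

context
  fixes \<gamma> lam :: "nat list"
  assumes \<gamma>: "is_partition \<gamma>"
begin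

abbreviation (input) "cells \<equiv> skew_shape \<gamma> lam"
abbreviation (input) "minT \<equiv> min_tableau \<gamma> lam"
abbreviation (input) "from_right x \<equiv> part \<gamma> (fst x) + 1 - snd x"

lemma min_tableau_cell:
  "x \<in> cells \<Longrightarrow> minT x = card {s \<in> long_rows \<gamma> lam (from_right x). s \<le> fst x}"
  by (cases x) (simp add: min_tableau_def)

lemma cell_long_row: "x \<in> cells \<Longrightarrow> fst x \<in> long_rows \<gamma> lam (from_right x)"
  by (cases x) (auto simp: skew_shape_def long_rows_def)

lemma from_right_ge_1: "x \<in> cells \<Longrightarrow> 1 \<le> from_right x"
  by (cases x) (auto simp: skew_shape_def)

lemma long_row_cell:
  assumes "1 \<le> c" "r \<in> long_rows \<gamma> lam c"
  shows "(r, part \<gamma> r + 1 - c) \<in> cells" "from_right (r, part \<gamma> r + 1 - c) = c"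
  using assms by (auto simp: skew_shape_def long_rows_def)

text \<open>Stepping right lowers the position \<open>c\<close> and so admits more rows. Stepping
  down lowers \<open>c\<close> weakly, because \<open>\<gamma>\<close> is a partition, and also
  counts the row of the lower cell.\<close>

lemma min_tableau_semistandard: "semistandard cells minT"
  unfolding semistandard_def
proof (intro conjI allI impI; (elim conjE)?)
  show "minT \<in> cells \<rightarrow>\<^sub>E {1..}"
  proof
    fix x assume x: "x \<in> cells"
    have "fst x \<in> {s \<in> long_rows \<gamma> lam (from_right x). s \<le> fst x}"
      using cell_long_row[OF x] by simp
    then have "0 < minT x"
      unfolding min_tableau_cell[OF x] card_gt_0_iff
      using finite_long_rows[OF from_right_ge_1[OF x]] by (auto intro: finite_subset)
    then show "minT x \<in> {1..}"
      by simp
  qed (simp add: min_tableau_def)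
next
  fix i j j' assume *: "(i, j) \<in> cells" "(i, j') \<in> cells" "j < j'"
  have "long_rows \<gamma> lam (from_right (i, j)) \<subseteq> long_rows \<gamma> lam (from_right (i, j'))"
    using *(3) by (auto simp: long_rows_def)
  then show "minT (i, j) \<le> minT (i, j')"
    unfolding min_tableau_cell[OF *(1)] min_tableau_cell[OF *(2)]
    using finite_long_rows[OF from_right_ge_1[OF *(2)]] by (intro card_mono) auto
next
  fix i i' j assume *: "(i, j) \<in> cells" "(i', j) \<in> cells" "i < i'"
  have "part \<gamma> i' \<le> part \<gamma> i"
    using * by (intro part_antimono[OF \<gamma>]) (auto simp: skew_shape_def)
  then have "long_rows \<gamma> lam (from_right (i, j)) \<subseteq> long_rows \<gamma> lam (from_right (i', j))"
    by (auto simp: long_rows_def)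
  from card_upto_strict_mono[OF finite_long_rows[OF from_right_ge_1[OF *(2)]] this *(3)]
    cell_long_row[OF *(2)]
  show "minT (i, j) < minT (i', j)"
    unfolding min_tableau_cell[OF *(1)] min_tableau_cell[OF *(2)] by simp
qed

text \<open>Among the cells with the same position \<open>c\<close> a label is the rank of its row,
  so \<open>c\<close> and \<open>k\<close> determine the cell.\<close>

lemma from_right_inj: "inj_on (\<lambda>x. from_right x) {x \<in> cells. minT x = k}"
proof (rule inj_onI, clarify)
  fix r j r' j'
  assume *: "(r, j) \<in> cells" "(r', j') \<in> cells" "minT (r', j') = minT (r, j)"
    and c: "from_right (r, j) = from_right (r', j')"
  note fin = finite_long_rows[OF from_right_ge_1[OF *(1)]]
  have mem: "r \<in> long_rows \<gamma> lam (from_right (r, j))"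
    "r' \<in> long_rows \<gamma> lam (from_right (r, j))"
    using cell_long_row[OF *(1)] cell_long_row[OF *(2)] c by auto
  have "card {s \<in> long_rows \<gamma> lam (from_right (r, j)). s \<le> r'} =
      card {s \<in> long_rows \<gamma> lam (from_right (r, j)). s \<le> r}"
    using *(3) min_tableau_cell[OF *(1)] min_tableau_cell[OF *(2)] c by simp
  then have "r = r'"
    using card_upto_strict_mono[OF fin order_refl _ mem(1), of r']
      card_upto_strict_mono[OF fin order_refl _ mem(2), of r]
    by (cases r r' rule: linorder_cases) simp_all
  then show "r = r' \<and> j = j'"
    using c *(1,2) by (auto simp: skew_shape_def)
qed

text \<open>By injectivity, cells with a given label may be replaced by their positions
  \<open>c\<close>. The label \<open>b - 1\<close> at the same position sits in a higher row and is
  read earlier.\<close>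

lemma min_tableau_lattice: "lattice_word (reverse_row_word cells minT)"
  unfolding lattice_word_reverse_row_word_iff[OF finite_skew_shape[OF \<gamma>]]
proof (intro allI impI, elim conjE)
  fix D b assume D: "initial_segment cells D" and b: "(2::nat) \<le> b"
  have DS: "D \<subseteq> cells"
    using D by (simp add: initial_segment_def)
  have inj: "inj_on (\<lambda>x. from_right x) {x \<in> D. minT x = k}" for k
    by (rule inj_on_subset[OF from_right_inj[of k]]) (use DS in auto)
  have "(\<lambda>x. from_right x) ` {x \<in> D. minT x = b} \<subseteq>
      (\<lambda>x. from_right x) ` {x \<in> D. minT x = b - 1}"
  proof
    fix c assume "c \<in> (\<lambda>x. from_right x) ` {x \<in> D. minT x = b}"
    then obtain x where x: "x \<in> D" "minT x = b" "c = from_right x"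
      by auto
    have xS: "x \<in> cells"
      using x DS by auto
    have c: "1 \<le> c"
      using from_right_ge_1[OF xS] x by simp
    let ?A = "long_rows \<gamma> lam c"
    have cardb: "card {s \<in> ?A. s \<le> fst x} = b"
      using min_tableau_cell[OF xS] x by simp
    moreover have "card {s \<in> ?A. s \<le> fst x} \<le> card ?A"
      using finite_long_rows[OF c] by (intro card_mono) auto
    \<comment> \<open>\<open>2 \<le> b\<close> makes the rank \<open>b - 1\<close> positive, so some
      row has it.\<close>
    ultimately have "\<exists>r\<in>?A. card {s \<in> ?A. s \<le> r} = b - 1"
      using b by (intro exists_kth_element finite_long_rows[OF c]) auto
    then obtain r where r: "r \<in> ?A" "card {s \<in> ?A. s \<le> r} = b - 1"
      by blast
    have "r < fst x"
    proof (rule ccontr)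
      assume "\<not> r < fst x"
      then have "card {s \<in> ?A. s \<le> fst x} \<le> card {s \<in> ?A. s \<le> r}"
        using finite_long_rows[OF c] by (intro card_mono) auto
      then show False
        using r cardb b by simp
    qed
    let ?y = "(r, part \<gamma> r + 1 - c)"
    have y: "?y \<in> cells" "from_right ?y = c"
      using long_row_cell[OF c r(1)] by auto
    have "read_before ?y x"
      using \<open>r < fst x\<close> by (simp add: read_before_def)
    then have "?y \<in> D"
      using D x(1) y(1) unfolding initial_segment_def by blast
    moreover have "minT ?y = b - 1"
      unfolding min_tableau_cell[OF y(1)] y(2) using r(2) by simp
    ultimately have "?y \<in> {x \<in> D. minT x = b - 1}"
      by blast
    then show "c \<in> (\<lambda>x. from_right x) ` {x \<in> D. minT x = b - 1}"
      unfolding image_iff using y(2)[symmetric] by (rule bexI[rotated])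
  qed
  moreover have "finite D"
    using DS finite_skew_shape[OF \<gamma>] finite_subset by blast
  ultimately show "card {x \<in> D. minT x = b} \<le> card {x \<in> D. minT x = b - 1}"
    unfolding card_image[OF inj, symmetric] by (intro card_mono) auto
qed

text \<open>A position \<open>c\<close> carries the label \<open>k\<close> exactly when at least
  \<open>k\<close> rows reach it; by conjugation the number of such positions is the
  \<open>k\<close>-th part.\<close>

lemma min_tableau_content: "has_content cells minT (row_partition cells)"
  unfolding has_content_def
proof (intro allI impI)
  fix k :: nat assume k: "1 \<le> k"
  have "(\<lambda>x. from_right x) ` {x \<in> cells. minT x = k} =
      {c. 1 \<le> c \<and> k \<le> card (long_rows \<gamma> lam c)}"
  proof (intro subset_antisym subsetI)
    fix c assume "c \<in> (\<lambda>x. from_right x) ` {x \<in> cells. minT x = k}"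
    then obtain x where x: "x \<in> cells" "minT x = k" "c = from_right x"
      by auto
    have c: "1 \<le> c"
      using from_right_ge_1[OF x(1)] x(3) by simp
    have "k = card {s \<in> long_rows \<gamma> lam c. s \<le> fst x}"
      using min_tableau_cell[OF x(1)] x by simp
    also have "\<dots> \<le> card (long_rows \<gamma> lam c)"
      using finite_long_rows[OF c] by (intro card_mono) auto
    finally show "c \<in> {c. 1 \<le> c \<and> k \<le> card (long_rows \<gamma> lam c)}"
      using c by simp
  next
    fix c assume "c \<in> {c. 1 \<le> c \<and> k \<le> card (long_rows \<gamma> lam c)}"
    then have c: "1 \<le> c" "k \<le> card (long_rows \<gamma> lam c)"
      by auto
    from exists_kth_element[OF finite_long_rows[OF c(1)] k c(2)]
    obtain r where r: "r \<in> long_rows \<gamma> lam c" "card {s \<in> long_rows \<gamma> lam c. s \<le> r} = k"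
      by blast
    let ?y = "(r, part \<gamma> r + 1 - c)"
    have y: "?y \<in> cells" "from_right ?y = c"
      using long_row_cell[OF c(1) r(1)] by auto
    have "minT ?y = k"
      unfolding min_tableau_cell[OF y(1)] y(2) using r(2) by simp
    with y(1) have "?y \<in> {x \<in> cells. minT x = k}"
      by blast
    then show "c \<in> (\<lambda>x. from_right x) ` {x \<in> cells. minT x = k}"
      unfolding image_iff using y(2)[symmetric] by (rule bexI[rotated])
  qed
  then have "card {x \<in> cells. minT x = k} = card {c. 1 \<le> c \<and> k \<le> card (long_rows \<gamma> lam c)}"
    using card_image[OF from_right_inj, of k] by simp
  \<comment> \<open>Rows are numbered from 1, so the rows below \<open>Suc (length \<gamma>)\<close>
    include row 0; it is empty and excluded by \<open>1 \<le> c\<close>.\<close>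
  also have "\<dots> = kth_largest (\<lambda>s. card {j. (s, j) \<in> cells}) (Suc (length \<gamma>)) k"
  proof -
    have "long_rows \<gamma> lam c = {s. s < Suc (length \<gamma>) \<and> c \<le> card {j. (s, j) \<in> cells}}"
      if "1 \<le> c" for c
    proof -
      have "{j. (s, j) \<in> cells} = (if 1 \<le> s then {part lam s<..part \<gamma> s} else {})" for s
        by (auto simp: skew_shape_def)
      then have "card {j. (s, j) \<in> cells} = (if 1 \<le> s then part \<gamma> s - part lam s else 0)" for s
        by simp
      then show ?thesis
        using that by (auto simp: long_rows_def part_def split: if_splits)
    qed
    then show ?thesis
      unfolding kth_largest_def
      by (intro arg_cong[where f=card] Collect_cong conj_cong refl) simp
  qed
  also have "\<dots> = part (row_partition cells) k"
  proof (rule part_row_partition[OF finite_skew_shape[OF \<gamma>] _ k, symmetric])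
    show "fst ` cells \<subseteq> {..<Suc (length \<gamma>)}"
      by (auto simp: skew_shape_def part_def split: if_splits)
  qed
  finally show "card {x \<in> cells. minT x = k} = part (row_partition cells) k" .
qed

lemma lr_tableaux_row_partition: "lr_tableaux \<gamma> lam (row_partition cells) = {minT}"
proof (intro subset_antisym subsetI)
  fix T assume "T \<in> lr_tableaux \<gamma> lam (row_partition cells)"
  then show "T \<in> {minT}"
    using lr_tableau_unique[OF finite_skew_shape[OF \<gamma>] _ _ _ min_tableau_semistandard
        min_tableau_content min_tableau_lattice]
    unfolding lr_tableaux_def by blast
next
  fix T assume "T \<in> {minT}"
  then show "T \<in> lr_tableaux \<gamma> lam (row_partition cells)"
    using min_tableau_semistandard min_tableau_content min_tableau_lattice
    by (simp add: lr_tableaux_def)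
qed

end

theorem theorem3p1:
  fixes \<gamma> lam :: "nat list"
  assumes "is_partition \<gamma>" and "is_partition lam" and "part_contained lam \<gamma>"
  shows "(\<forall>\<mu>. is_partition \<mu> \<and> lr_coeff \<gamma> lam \<mu> \<noteq> 0 \<longrightarrow>
            (\<forall>i\<ge>1. lower_deriv i (skew_shape \<gamma> lam) \<le>\<^sub>G drop i \<mu>)) \<and>
         is_partition (lower_deriv 0 (skew_shape \<gamma> lam)) \<and>
         lr_coeff \<gamma> lam (lower_deriv 0 (skew_shape \<gamma> lam)) = 1 \<and>
         (\<forall>\<mu>. is_partition \<mu> \<and> lr_coeff \<gamma> lam \<mu> \<noteq> 0 \<longrightarrow>
            lower_deriv 0 (skew_shape \<gamma> lam) \<le>\<^sub>G \<mu>)"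
proof -
  let ?S = "skew_shape \<gamma> lam"
  note S = finite_skew_shape[OF assms(1), of lam]
  have dom: "lower_deriv i ?S \<le>\<^sub>G drop i \<mu>" if "lr_coeff \<gamma> lam \<mu> \<noteq> 0" for i \<mu>
  proof -
    have "lr_tableaux \<gamma> lam \<mu> \<noteq> {}"
      using that by (auto simp: lr_coeff_def)
    then obtain T where "T \<in> lr_tableaux \<gamma> lam \<mu>"
      by blast
    then show ?thesis
      unfolding lr_tableaux_def by (intro lower_deriv_le_drop[OF S, of T]) auto
  qed
  \<comment> \<open>Minimality is the case \<open>i = 0\<close> of the same bound, where nothing is
    dropped from \<open>\<mu>\<close>.\<close>
  moreover have "lower_deriv 0 ?S \<le>\<^sub>G \<mu>" if "lr_coeff \<gamma> lam \<mu> \<noteq> 0" for \<mu>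
    using dom[OF that, of 0] by simp
  moreover have "lower_deriv 0 ?S = row_partition ?S"
    by (simp add: lower_deriv_def)
  ultimately show ?thesis
    using is_partition_row_partition[OF S] lr_tableaux_row_partition[OF assms(1), of lam]
    by (simp add: lr_coeff_def)
qed

end
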